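(* The set $\overline{\mathsf{R}}\subseteq\mathbb{Z}[i]^{\mathbb{N}}$, regarded as a subshift with the left shift map $\sigma$, has the right feeble specification property.
   Context: For $z\in\mathbb{C}$, $[z]:=\lfloor \mathrm{Re}(z)+\tfrac12\rfloor+i\lfloor \mathrm{Im}(z)+\tfrac12\rfloor$; $\mathfrak{F}:=\{z: -\tfrac12\le \mathrm{Re}(z)<\tfrac12,\ -\tfrac12\le \mathrm{Im}(z)<\tfrac12\}$; $T(0)=0$ and $T(z)=z^{-1}-[z^{-1}]$ for $z\in\mathfrak{F}\setminus\{0\}$; $a_1(z)=[z^{-1}]$, $a_n(z)=a_1(T^{n-1}(z))$ when $T^{n-1}(z)\neq0$. Cylinders $\mathcal{C}_n(b_1,\dots,b_n):=\{z\in\mathfrak{F}: a_j(z)=b_j,\ 1\le j\le n\}$, with interior $\mathcal{C}^{\circ}_n(b_1,\dots,b_n)$. $\overline{\mathsf{R}}:=\{(a_n)\in\mathbb{Z}[i]^{\mathbb{N}}:\forall n,\ \mathcal{C}^{\circ}_n(a_1,\dots,a_n)\ne\emptyset\}$, with the product topology (discrete topology on $\mathbb{Z}[i]$), and $\sigma((x_n)_{n\ge1})=(x_{n+1})_{n\ge1}$. For a subshift $X$ over an alphabet $\mathcal{A}$, $\mathcal{L}(X)$ denotes the set of finite words occurring as factors of elements of $X$; $|\mathbf{u}|$ is the length of a finite word; $\mathbf{u}\mathbf{v}$ is concatenation; for words $\mathbf{v}=(v_1,\dots,v_n)$, $\mathbf{w}=(w_1,\dots,w_n)$ of equal length, $d_H(\mathbf{v},\mathbf{w})=\#\{j: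 v_j\ne w_j\}/n$. $X$ has the right feeble specification property if there is $\mathcal{G}\subseteq\mathcal{L}(X)$ such that (i) $\mathbf{u},\mathbf{v}\in\mathcal{G}$ implies $\mathbf{u}\mathbf{v}\in\mathcal{G}$; (ii) for every $\varepsilon>0$ there is $N\in\mathbb{N}$ such that for every $\mathbf{u}\in\mathcal{G}$ and every $\mathbf{v}\in\mathcal{L}(X)$ with $|\mathbf{v}|\ge N$ there exist finite words $\mathbf{s},\mathbf{v}'$ over $\mathcal{A}$ (with $\mathbf{s}$ possibly empty) with $|\mathbf{v}'|=|\mathbf{v}|$, $0\le|\mathbf{s}|\le\varepsilon|\mathbf{v}|$, $d_H(\mathbf{v},\mathbf{v}')<\varepsilon$ and $\mathbf{u}\mathbf{s}\mathbf{v}'\in\mathcal{G}$. *)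

theory Defs
  imports "HOL-Analysis.Analysis"
begin

subsection \<open>Words and subshifts\<close>

text \<open>One-sided sequences \<open>(x\<^sub>n)\<close> with \<open>n \<ge> 1\<close> are functions on \<^typ>\<open>nat\<close>, the value at \<open>n\<close> being
  \<open>x\<^sub>n\<^sub>+\<^sub>1\<close>. Finite words are lists. The alphabet is a set \<open>A\<close>, not a whole type.\<close>

definition shift :: "(nat \<Rightarrow> 'a) \<Rightarrow> nat \<Rightarrow> 'a" where
  "shift x = (\<lambda>n. x (Suc n))"

definition subshift :: "'a set \<Rightarrow> (nat \<Rightarrow> 'a) set \<Rightarrow> bool" where
  "subshift A X \<longleftrightarrow>
     closedin (product_topology (\<lambda>_. discrete_topology A) UNIV) X \<and> shift ` X \<subseteq> X"

definition language :: "(nat \<Rightarrow> 'a) set \<Rightarrow> 'a list set" where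
  "language X = {map x [i..<i + n] | x i n. x \<in> X}"

text \<open>Only meant for words of equal length.\<close>

definition hamming_dist :: "'a list \<Rightarrow> 'a list \<Rightarrow> real" where
  "hamming_dist v w = real (card {j. j < length v \<and> v ! j \<noteq> w ! j}) / real (length v)"

text \<open>Without \<open>G \<noteq> {}\<close> every \<open>X\<close> would have the property, with the empty set as \<open>G\<close>.\<close>

definition right_feeble_specification :: "'a set \<Rightarrow> (nat \<Rightarrow> 'a) set \<Rightarrow> bool" where
  "right_feeble_specification A X \<longleftrightarrow>
     (\<exists>G \<subseteq> language X. G \<noteq> {} \<and>
        (\<forall>u\<in>G. \<forall>v\<in>G. u @ v \<in> G) \<and>
        (\<forall>\<epsilon>::real. \<epsilon> > 0 \<longrightarrow>
           (\<exists>N::nat. \<forall>u\<in>G. \<forall>v\<in>language X. length v \<ge> N \<longrightarrow>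
              (\<exists>s\<in>lists A. \<exists>v'\<in>lists A.
                 length v' = length v \<and>
                 real (length s) \<le> \<epsilon> * real (length v) \<and>
                 hamming_dist v v' < \<epsilon> \<and>
                 u @ s @ v' \<in> G))))"


subsection \<open>Hurwitz continued fractions\<close>

definition gauss_ints :: "complex set" where
  "gauss_ints = {z. Re z \<in> \<int> \<and> Im z \<in> \<int>}"

definition nearest_gauss :: "complex \<Rightarrow> complex" where
  "nearest_gauss z =
     of_int \<lfloor>Re z + 1/2\<rfloor> + \<i> * of_int \<lfloor>Im z + 1/2\<rfloor>"

definition hurwitz_domain :: "complex set" where
  "hurwitz_domain = {z. -1/2 \<le> Re z \<and> Re z < 1/2 \<and> -1/2 \<le> Im z \<and> Im z < 1/2}"

definition hurwitz_map :: "complex \<Rightarrow> complex" where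
  "hurwitz_map z = (if z = 0 then 0 else inverse z - nearest_gauss (inverse z))"

text \<open>\<open>hurwitz_digit n z\<close> is the partial quotient \<open>a\<^sub>n\<^sub>+\<^sub>1(z)\<close>; it is \<^term>\<open>None\<close> once the expansion
  has terminated, so that cylinders contain only points all of whose relevant digits exist.\<close>

definition hurwitz_digit :: "nat \<Rightarrow> complex \<Rightarrow> complex option" where
  "hurwitz_digit n z =
     (let w = (hurwitz_map ^^ n) z
      in if w = 0 then None else Some (nearest_gauss (inverse w)))"

definition cylinder :: "complex list \<Rightarrow> complex set" where
  "cylinder bs =
     {z \<in> hurwitz_domain. \<forall>j < length bs. hurwitz_digit j z = Some (bs ! j)}"

definition Rbar :: "(nat \<Rightarrow> complex) set" where
  "Rbar = {a. (\<forall>n. a n \<in> gauss_ints) \<and>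
              (\<forall>n\<ge>1. interior (cylinder (map a [0..<n])) \<noteq> {})}"

end

theory Submission
  imports Defs "HOL-Library.Sublist"
begin

text \<open>
  Up to boundary points, \<open>T\<^sup>n\<close> maps the cylinder of a word of length \<open>n\<close> onto an open set, its
  followers; the word is full if this set is the whole open square. Full words are closed under
  concatenation. The followers of any admissible word are the open square minus some of the closed
  unit discs around \<open>p\<close>, \<open>q \<i>\<close> and \<open>p + q \<i>\<close>, for suitable signs \<open>p, q\<close>. This leaves the quadrant
  opposite to \<open>p + q \<i>\<close> untouched near the origin, so the letter \<open>- 3 (p - q \<i>)\<close> may follow, and it
  makes the word full. Hence changing only the last letter turns any word of the language into a full
  word, and \<open>s\<close> can be empty.
\<close>

subsection \<open>Subshifts given by their admissible prefixes\<close>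

definition prefix_shift :: "'a list set \<Rightarrow> (nat \<Rightarrow> 'a) set" where
  "prefix_shift W = {x. \<forall>n. map x [0..<n] \<in> W}"

definition factor_closed :: "'a list set \<Rightarrow> bool" where
  "factor_closed W \<longleftrightarrow> (\<forall>w\<in>W. \<forall>v. sublist v w \<longrightarrow> v \<in> W)"

lemma factor_closedD: "factor_closed W \<Longrightarrow> w \<in> W \<Longrightarrow> sublist v w \<Longrightarrow> v \<in> W"
  by (simp add: factor_closed_def)

lemma map_upt_add: "map x [0..<i + n] = map x [0..<i] @ map x [i..<i + n]"
  by (simp add: upt_add_eq_append[of 0 i n])

lemma shift_prefix_shift_subset:
  assumes "factor_closed W"
  shows "shift ` prefix_shift W \<subseteq> prefix_shift W"
proof (clarsimp simp: prefix_shift_def)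
  fix x n
  assume x: "\<forall>n. map x [0..<n] \<in> W"
  have "map x [0..<1 + n] = [x 0] @ map (shift x) [0..<n]"
    by (rule nth_equalityI) (auto simp: shift_def nth_Cons simp del: upt_Suc split: nat.split)
  then have "sublist (map (shift x) [0..<n]) (map x [0..<1 + n])"
    by (simp only: sublist_append_leftI)
  then show "map (shift x) [0..<n] \<in> W"
    using x factor_closedD[OF assms] by blast
qed

lemma openin_prefix_cylinder:
  fixes x :: "nat \<Rightarrow> 'a"
  assumes "range x \<subseteq> A"
  shows "openin (product_topology (\<lambda>_. discrete_topology A) UNIV)
           {y. range y \<subseteq> A \<and> map y [0..<n] = map x [0..<n]}"
proof -
  have "{y. range y \<subseteq> A \<and> map y [0..<n] = map x [0..<n]} =
      (\<Pi>\<^sub>E i\<in>UNIV. if i < n then {x i} else A)"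
  proof (rule set_eqI)
    fix y
    have "range y \<subseteq> A \<and> (\<forall>i<n. y i = x i) \<longleftrightarrow> (\<forall>i. y i \<in> (if i < n then {x i} else A))"
      using assms by (metis empty_iff insert_iff rangeI range_subsetD image_subset_iff)
    then show "y \<in> {y. range y \<subseteq> A \<and> map y [0..<n] = map x [0..<n]} \<longleftrightarrow>
        y \<in> (\<Pi>\<^sub>E i\<in>UNIV. if i < n then {x i} else A)"
      by (simp add: PiE_iff atLeast0LessThan Ball_def)
  qed
  moreover have "finite {i. (if i < n then {x i} else A) \<noteq> A}"
    by (rule finite_subset[of _ "{..<n}"]) auto
  ultimately show ?thesis
    using assms by (auto simp: openin_PiE_gen)
qed

lemma closedin_prefix_shift:
  assumes "W \<subseteq> lists A"
  shows "closedin (product_topology (\<lambda>_. discrete_topology A) UNIV) (prefix_shift W)"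
proof -
  let ?T = "product_topology (\<lambda>_::nat. discrete_topology A) UNIV"
  have space: "topspace ?T = {x. range x \<subseteq> A}"
    by (auto simp: PiE_iff)
  have "x n \<in> A" if "x \<in> prefix_shift W" for x n
  proof -
    have "map x [0..<Suc n] \<in> lists A"
      using that assms unfolding prefix_shift_def by blast
    then show ?thesis by simp
  qed
  then have "prefix_shift W \<subseteq> topspace ?T"
    unfolding space by blast
  moreover have "openin ?T (topspace ?T - prefix_shift W)"
  proof (subst openin_subopen, intro ballI)
    fix x
    assume "x \<in> topspace ?T - prefix_shift W"
    then obtain n where x: "range x \<subseteq> A" and n: "map x [0..<n] \<notin> W"
      unfolding space by (auto simp: prefix_shift_def)
    let ?U = "{y. range y \<subseteq> A \<and> map y [0..<n] = map x [0..<n]}"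
    have "?U \<subseteq> topspace ?T - prefix_shift W"
    proof
      fix y
      assume y: "y \<in> ?U"
      then have "map y [0..<n] = map x [0..<n]"
        by blast
      then have "map y [0..<n] \<notin> W"
        using n by (simp only: not_False_eq_True)
      then show "y \<in> topspace ?T - prefix_shift W"
        using y unfolding space prefix_shift_def by blast
    qed
    moreover have "x \<in> ?U"
      using x by simp
    ultimately show "\<exists>U. openin ?T U \<and> x \<in> U \<and> U \<subseteq> topspace ?T - prefix_shift W"
      using openin_prefix_cylinder[OF x] by blast
  qed
  ultimately show ?thesis by (simp add: closedin_def)
qed

lemma subshift_prefix_shift:
  assumes "W \<subseteq> lists A" "factor_closed W"
  shows "subshift A (prefix_shift W)"
  using closedin_prefix_shift[OF assms(1)] shift_prefix_shift_subset[OF assms(2)]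
  unfolding subshift_def by blast

lemma language_prefix_shift_subset:
  assumes "factor_closed W"
  shows "language (prefix_shift W) \<subseteq> W"
proof
  fix v
  assume "v \<in> language (prefix_shift W)"
  then obtain x i n where x: "x \<in> prefix_shift W" and v: "v = map x [i..<i + n]"
    unfolding language_def by blast
  have "sublist v (map x [0..<i + n])"
    unfolding v map_upt_add by (rule sublist_append_leftI)
  then show "v \<in> W"
    using x factor_closedD[OF assms] unfolding prefix_shift_def by blast
qed

lemma subset_language_prefix_shift:
  assumes "factor_closed W"
    and extendable: "\<And>w. w \<in> W \<Longrightarrow> \<exists>a. w @ [a] \<in> W"
  shows "W \<subseteq> language (prefix_shift W)"
proof
  fix w
  assume w: "w \<in> W"
  obtain e where e: "\<And>u. u \<in> W \<Longrightarrow> u @ [e u] \<in> W"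
    using extendable by metis
  define ws where "ws n = ((\<lambda>u. u @ [e u]) ^^ n) w" for n
  have ws_Suc: "ws (Suc n) = ws n @ [e (ws n)]" for n
    by (simp add: ws_def)
  have ws_0: "ws 0 = w"
    by (simp add: ws_def)
  have ws_in: "ws n \<in> W" for n
    by (induction n) (auto simp: ws_0 ws_Suc w e)
  have length_ws: "length (ws n) = length w + n" for n
    by (induction n) (auto simp: ws_0 ws_Suc)
  have nth_ws: "ws (m + k) ! i = ws m ! i" if "i < length w + m" for m k i
    using that by (induction k) (auto simp: ws_Suc nth_append length_ws)
  define x where "x i = ws (Suc i) ! i" for i
  have x_eq: "x i = ws n ! i" if "i < length w + n" for i n
    using nth_ws[of i "Suc i" n] nth_ws[of i n "Suc i"] that by (simp add: x_def add.commute)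
  have x_prefix: "map x [0..<k] = take k (ws n)" if "k \<le> length w + n" for k n
    using that by (intro nth_equalityI) (auto simp: length_ws x_eq[of _ n])
  have "map x [0..<n] \<in> W" for n
    unfolding x_prefix[of n n, OF le_add2]
    by (rule factor_closedD[OF assms(1) ws_in[of n] sublist_take])
  moreover have "w = map x [0..<0 + length w]"
    using x_prefix[of "length w" 0] by (simp add: ws_0)
  ultimately show "w \<in> language (prefix_shift W)"
    unfolding language_def prefix_shift_def by blast
qed

lemma language_prefix_shift:
  assumes "factor_closed W" "\<And>w. w \<in> W \<Longrightarrow> \<exists>a. w @ [a] \<in> W"
  shows "language (prefix_shift W) = W"
  using language_prefix_shift_subset[OF assms(1)] subset_language_prefix_shift[OF assms] ..

lemma right_feeble_specification_if_bounded_mismatch: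
  assumes G: "G \<subseteq> language X" "G \<subseteq> lists A" "G \<noteq> {}"
    and append: "\<And>u v. u \<in> G \<Longrightarrow> v \<in> G \<Longrightarrow> u @ v \<in> G"
    and mismatch: "\<And>v. v \<in> language X \<Longrightarrow> v \<noteq> [] \<Longrightarrow>
      \<exists>v'\<in>G. length v' = length v \<and> card {j. j < length v \<and> v ! j \<noteq> v' ! j} \<le> K"
  shows "right_feeble_specification A X"
proof -
  have "\<exists>N. \<forall>u\<in>G. \<forall>v\<in>language X. length v \<ge> N \<longrightarrow>
      (\<exists>s\<in>lists A. \<exists>v'\<in>lists A. length v' = length v \<and>
        real (length s) \<le> \<epsilon> * real (length v) \<and> hamming_dist v v' < \<epsilon> \<and> u @ s @ v' \<in> G)"
    if \<epsilon>: "\<epsilon> > 0" for \<epsilon> :: real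
  proof -
    obtain N where N: "real K / \<epsilon> < real N"
      using reals_Archimedean2 by blast
    show ?thesis
    proof (intro exI[of _ N] ballI impI)
      fix u v
      assume u: "u \<in> G" and v: "v \<in> language X" and len: "N \<le> length v"
      have "real K / \<epsilon> < real (length v)"
        using N len by linarith
      then have K: "real K < \<epsilon> * real (length v)"
        using \<epsilon> by (simp add: field_simps)
      then have "v \<noteq> []"
        by auto
      then obtain v' where v': "v' \<in> G" "length v' = length v"
        and mm: "card {j. j < length v \<and> v ! j \<noteq> v' ! j} \<le> K"
        using mismatch[OF v] by blast
      have "hamming_dist v v' < \<epsilon>"
        using K mm \<open>v \<noteq> []\<close> by (simp add: hamming_dist_def divide_less_eq)
      then show "\<exists>s\<in>lists A. \<exists>v'\<in>lists A. length v' = length v \<and>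
          real (length s) \<le> \<epsilon> * real (length v) \<and> hamming_dist v v' < \<epsilon> \<and> u @ s @ v' \<in> G"
        using v' append[OF u v'(1)] G(2) \<epsilon>
        by (intro bexI[of _ "[]"] bexI[of _ v']) auto
    qed
  qed
  then show ?thesis
    using G append unfolding right_feeble_specification_def by (intro exI[of _ G]) simp
qed

lemma card_mismatch_last_le: "card {j. j < length (u @ [a]) \<and> (u @ [a]) ! j \<noteq> (u @ [b]) ! j} \<le> 1"
proof -
  have "{j. j < length (u @ [a]) \<and> (u @ [a]) ! j \<noteq> (u @ [b]) ! j} \<subseteq> {length u}"
    by (auto simp: nth_append)
  then show ?thesis
    using card_mono[of "{length u}"] by simp
qed

subsection \<open>Cylinders and their followers\<close>

definition open_square :: "complex set" where
  "open_square = {z. \<bar>Re z\<bar> < 1/2 \<and> \<bar>Im z\<bar> < 1/2}"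

definition follower_step :: "complex set \<Rightarrow> complex \<Rightarrow> complex set" where
  "follower_step X b = {f \<in> open_square. b + f \<noteq> 0 \<and> inverse (b + f) \<in> X}"

definition followers :: "complex list \<Rightarrow> complex set" where
  "followers w = foldl follower_step open_square w"

definition admissible_words :: "complex list set" where
  "admissible_words = {w \<in> lists gauss_ints. followers w \<noteq> {}}"

lemma zero_in_open_square: "0 \<in> open_square"
  by (simp add: open_square_def)

lemma norm_less_1_if_open_square:
  assumes "z \<in> open_square"
  shows "norm z < 1"
  using assms cmod_le[of z] by (simp add: open_square_def)

lemma interior_hurwitz_domain: "interior hurwitz_domain = open_square"
proof -
  let ?a = "Complex (-1/2) (-1/2)" and ?b = "Complex (1/2) (1/2)"
  have box: "open_square = box ?a ?b"
    by (auto simp: open_square_def in_box_complex_iff)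
  have "hurwitz_domain \<subseteq> cbox ?a ?b"
    by (auto simp: hurwitz_domain_def in_cbox_complex_iff)
  then have "interior hurwitz_domain \<subseteq> open_square"
    unfolding box using interior_mono[of _ "cbox ?a ?b"] by simp
  moreover have "open_square \<subseteq> hurwitz_domain"
    by (auto simp: open_square_def hurwitz_domain_def)
  then have "open_square \<subseteq> interior hurwitz_domain"
    unfolding box by (rule interior_maximal[OF _ open_box])
  ultimately show ?thesis ..
qed

lemma gauss_intsE:
  assumes "b \<in> gauss_ints"
  obtains x y :: int where "b = Complex (of_int x) (of_int y)"
  using assms by (auto simp: gauss_ints_def complex_eq_iff elim!: Ints_cases)

lemma nearest_gauss_eq_iff:
  assumes "b \<in> gauss_ints"
  shows "nearest_gauss w = b \<longleftrightarrow> w - b \<in> hurwitz_domain"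
proof -
  obtain m n where "b = Complex (of_int m) (of_int n)"
    using assms by (rule gauss_intsE)
  then show ?thesis
    by (auto simp: nearest_gauss_def hurwitz_domain_def complex_eq_iff floor_eq_iff)
qed

lemma cylinder_Cons:
  assumes "b \<in> gauss_ints"
  shows "cylinder (b # bs) = {z \<in> hurwitz_domain. z \<noteq> 0 \<and> inverse z - b \<in> cylinder bs}"
proof -
  have digit_0: "hurwitz_digit 0 z = Some b \<longleftrightarrow> z \<noteq> 0 \<and> inverse z - b \<in> hurwitz_domain" for z
    using nearest_gauss_eq_iff[OF assms] by (auto simp: hurwitz_digit_def Let_def)
  have digit_Suc: "hurwitz_digit (Suc j) z = hurwitz_digit j (inverse z - b)"
    if "z \<noteq> 0" "inverse z - b \<in> hurwitz_domain" for z j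
  proof -
    have "hurwitz_map z = inverse z - b"
      using that nearest_gauss_eq_iff[OF assms] by (simp add: hurwitz_map_def)
    then show ?thesis
      by (simp add: hurwitz_digit_def funpow_Suc_right del: funpow.simps)
  qed
  show ?thesis
    by (auto simp: cylinder_def All_less_Suc2 digit_0 digit_Suc)
qed

lemma interior_homeomorphism_vimage:
  assumes hom: "homeomorphism S T f g" and "open S" "open T"
  shows "interior (S \<inter> f -` A) = S \<inter> f -` interior A"
proof (rule interior_unique)
  show "S \<inter> f -` interior A \<subseteq> S \<inter> f -` A"
    using interior_subset by blast
  show "open (S \<inter> f -` interior A)"
    using hom \<open>open S\<close> by (auto intro: continuous_open_preimage dest: homeomorphism_cont1)
next
  fix U
  assume U: "U \<subseteq> S \<inter> f -` A" "open U"
  have "open (T \<inter> g -` U)"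
    using hom U \<open>open T\<close> by (auto intro: continuous_open_preimage dest: homeomorphism_cont2)
  moreover have "T \<inter> g -` U \<subseteq> A"
    using U hom by (force simp: homeomorphism_def)
  ultimately have "T \<inter> g -` U \<subseteq> interior A"
    by (simp add: interior_maximal)
  then show "U \<subseteq> S \<inter> f -` interior A"
    using U hom by (force simp: homeomorphism_def)
qed

lemma homeomorphism_inverse_translate:
  fixes b :: "'a::real_normed_div_algebra"
  shows "homeomorphism (- {0}) (- {- b}) (\<lambda>z. inverse z - b) (\<lambda>f. inverse (b + f))"
  by (rule homeomorphismI) (auto intro!: continuous_intros simp: add_eq_0_iff)

lemma interior_cylinder_Cons:
  assumes "b \<in> gauss_ints"
  shows "interior (cylinder (b # bs)) =
    {z \<in> open_square. z \<noteq> 0 \<and> inverse z - b \<in> interior (cylinder bs)}"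
proof -
  have "cylinder (b # bs) = hurwitz_domain \<inter> (- {0} \<inter> (\<lambda>z. inverse z - b) -` cylinder bs)"
    using assms by (auto simp: cylinder_Cons)
  then show ?thesis
    using interior_homeomorphism_vimage[OF homeomorphism_inverse_translate, of b "cylinder bs"]
    by (auto simp: interior_Int interior_hurwitz_domain)
qed

lemma interior_cylinder_subset: "interior (cylinder bs) \<subseteq> open_square"
  unfolding interior_hurwitz_domain[symmetric] by (rule interior_mono) (auto simp: cylinder_def)

lemma follower_step_subset: "follower_step X b \<subseteq> open_square"
  by (auto simp: follower_step_def)

lemma Int_interior_cylinder_nonempty_iff:
  assumes "bs \<in> lists gauss_ints" "X \<subseteq> open_square"
  shows "X \<inter> interior (cylinder bs) \<noteq> {} \<longleftrightarrow> foldl follower_step X bs \<noteq> {}"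
  using assms
proof (induction bs arbitrary: X rule: lists.induct)
  case Nil
  then show ?case
    by (simp add: cylinder_def interior_hurwitz_domain Int_absorb2)
next
  case (Cons b bs)
  have "X \<inter> interior (cylinder (b # bs)) \<noteq> {} \<longleftrightarrow>
      (\<exists>z\<in>X. z \<noteq> 0 \<and> inverse z - b \<in> interior (cylinder bs))"
    using Cons.prems by (auto simp: interior_cylinder_Cons[OF Cons.hyps(1)])
  also have "\<dots> \<longleftrightarrow> (\<exists>f\<in>interior (cylinder bs). b + f \<noteq> 0 \<and> inverse (b + f) \<in> X)"
  proof
    assume "\<exists>z\<in>X. z \<noteq> 0 \<and> inverse z - b \<in> interior (cylinder bs)"
    then obtain z where "z \<in> X" "z \<noteq> 0" "inverse z - b \<in> interior (cylinder bs)"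
      by blast
    then show "\<exists>f\<in>interior (cylinder bs). b + f \<noteq> 0 \<and> inverse (b + f) \<in> X"
      by (intro bexI[of _ "inverse z - b"]) auto
  next
    assume "\<exists>f\<in>interior (cylinder bs). b + f \<noteq> 0 \<and> inverse (b + f) \<in> X"
    then obtain f where "f \<in> interior (cylinder bs)" "b + f \<noteq> 0" "inverse (b + f) \<in> X"
      by blast
    then show "\<exists>z\<in>X. z \<noteq> 0 \<and> inverse z - b \<in> interior (cylinder bs)"
      by (intro bexI[of _ "inverse (b + f)"]) auto
  qed
  also have "\<dots> \<longleftrightarrow> follower_step X b \<inter> interior (cylinder bs) \<noteq> {}"
    using interior_cylinder_subset by (auto simp: follower_step_def)
  also have "\<dots> \<longleftrightarrow> foldl follower_step (follower_step X b) bs \<noteq> {}"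
    by (rule Cons.IH[OF follower_step_subset])
  finally show ?case by simp
qed

lemma interior_cylinder_nonempty_iff:
  assumes "bs \<in> lists gauss_ints"
  shows "interior (cylinder bs) \<noteq> {} \<longleftrightarrow> followers bs \<noteq> {}"
  using Int_interior_cylinder_nonempty_iff[OF assms subset_refl] interior_cylinder_subset
  by (simp add: followers_def Int_absorb1)

lemma Rbar_eq_prefix_shift: "Rbar = prefix_shift admissible_words"
proof (intro set_eqI iffI)
  fix a
  assume a: "a \<in> Rbar"
  have "map a [0..<n] \<in> admissible_words" for n
  proof (cases "n = 0")
    case True
    then show ?thesis
      using zero_in_open_square by (auto simp: admissible_words_def followers_def)
  next
    case False
    have gauss: "map a [0..<n] \<in> lists gauss_ints"
      using a by (auto simp: Rbar_def)
    have "interior (cylinder (map a [0..<n])) \<noteq> {}"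
      using a False by (simp add: Rbar_def)
    then show ?thesis
      using gauss interior_cylinder_nonempty_iff[OF gauss]
      by (simp add: admissible_words_def del: in_lists_conv_set)
  qed
  then show "a \<in> prefix_shift admissible_words"
    by (simp add: prefix_shift_def)
next
  fix a
  assume "a \<in> prefix_shift admissible_words"
  then have adm: "map a [0..<n] \<in> admissible_words" for n
    by (simp add: prefix_shift_def)
  have "a n \<in> gauss_ints" for n
    using adm[of "Suc n"] by (simp add: admissible_words_def)
  moreover have "interior (cylinder (map a [0..<n])) \<noteq> {}" for n
    using adm[of n] interior_cylinder_nonempty_iff[of "map a [0..<n]"]
    by (auto simp: admissible_words_def)
  ultimately show "a \<in> Rbar"
    by (simp add: Rbar_def)
qed

subsection \<open>Admissible and full words\<close>

definition full_words :: "complex list set" where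
  "full_words = {w \<in> lists gauss_ints. followers w = open_square}"

lemma followers_append: "followers (u @ v) = foldl follower_step (followers u) v"
  by (simp add: followers_def)

lemma foldl_follower_step_empty: "foldl follower_step {} v = {}"
  by (induction v) (auto simp: follower_step_def)

lemma foldl_follower_step_mono:
  assumes "X \<subseteq> Y"
  shows "foldl follower_step X v \<subseteq> foldl follower_step Y v"
  using assms
proof (induction v arbitrary: X Y)
  case (Cons b v)
  have "follower_step X b \<subseteq> follower_step Y b"
    using Cons.prems by (auto simp: follower_step_def)
  then show ?case
    using Cons.IH by simp
qed simp

lemma followers_subset: "followers u \<subseteq> open_square"
  by (cases u rule: rev_cases) (simp_all add: followers_def follower_step_subset)

lemma followers_append_subset: "followers (u @ v) \<subseteq> followers v"
  unfolding followers_append followers_def[of v]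
  by (rule foldl_follower_step_mono[OF followers_subset])

lemma factor_closed_admissible_words: "factor_closed admissible_words"
  unfolding factor_closed_def
proof (intro ballI allI impI)
  fix w v
  assume w: "w \<in> admissible_words" and "sublist v w"
  then obtain u t where split: "w = u @ v @ t"
    by (auto simp: sublist_def)
  have "followers (v @ t) \<noteq> {}"
    using w followers_append_subset[of u "v @ t"] by (auto simp: admissible_words_def split)
  then have "followers v \<noteq> {}"
    unfolding followers_append using foldl_follower_step_empty by metis
  then show "v \<in> admissible_words"
    using w by (auto simp: admissible_words_def split)
qed

lemma full_words_append:
  assumes "u \<in> full_words" "v \<in> full_words"
  shows "u @ v \<in> full_words"
  using assms by (simp add: full_words_def followers_append followers_def)

lemma full_words_subset_admissible_words: "full_words \<subseteq> admissible_words"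
  using zero_in_open_square by (auto simp: full_words_def admissible_words_def)

lemma Nil_in_full_words: "[] \<in> full_words"
  by (simp add: full_words_def followers_def)

subsection \<open>The shape of the followers\<close>

definition gauss_units :: "complex set" where
  "gauss_units = {1, -1, \<i>, -\<i>}"

definition gauss_diagonals :: "complex set" where
  "gauss_diagonals = {d. \<bar>Re d\<bar> = 1 \<and> \<bar>Im d\<bar> = 1}"

definition quadrant_centres :: "complex \<Rightarrow> complex set" where
  "quadrant_centres d = {Complex (Re d) 0, Complex 0 (Im d), d}"

definition square_minus_discs :: "complex set \<Rightarrow> complex set" where
  "square_minus_discs S = open_square - (\<Union>c\<in>S. cball c 1)"

definition quadrantal :: "complex set \<Rightarrow> bool" where
  "quadrantal E \<longleftrightarrow>
     (\<exists>d\<in>gauss_diagonals. \<exists>S\<subseteq>quadrant_centres d. E = square_minus_discs S)"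

text \<open>Inversion maps the complement of the disc around a unit \<open>c\<close> to the half-plane \<open>Re (c w) < 1/2\<close>,
  which contains or misses any translate of the open square by a Gaussian integer, and preserves the
  complement of the disc around a diagonal point up to conjugation. The four units come from the
  sides of the square.\<close>

definition inverted_centres :: "complex set \<Rightarrow> complex set" where
  "inverted_centres S = gauss_units \<union> cnj ` (S \<inter> gauss_diagonals)"

lemma mem_square_minus_discs_iff:
  "z \<in> square_minus_discs S \<longleftrightarrow> z \<in> open_square \<and> (\<forall>c\<in>S. dist c z > 1)"
  by (auto simp: square_minus_discs_def not_le)

lemma dist_inverse_gt_1_iff:
  fixes c w :: complex
  assumes "w \<noteq> 0"
  shows "dist c (inverse w) > 1 \<longleftrightarrow> (norm w)\<^sup>2 < 1 - 2 * Re (c * w) + (norm c)\<^sup>2 * (norm w)\<^sup>2"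
proof -
  have "c - inverse w = (c * w - 1) / w"
    using assms by (simp add: field_simps)
  then have "dist c (inverse w) > 1 \<longleftrightarrow> norm w < norm (c * w - 1)"
    using assms by (simp add: dist_norm norm_divide)
  also have "\<dots> \<longleftrightarrow> (norm w)\<^sup>2 < (norm (c * w - 1))\<^sup>2"
    by (simp add: power_mono_iff flip: not_le)
  also have "(norm (c * w - 1))\<^sup>2 = 1 - 2 * Re (c * w) + (norm (c * w))\<^sup>2"
    unfolding cmod_power2 by (simp add: power2_diff)
  finally show ?thesis
    by (simp add: norm_mult power_mult_distrib)
qed

lemma dist_unit_inverse_gt_1_iff:
  fixes c w :: complex
  assumes "w \<noteq> 0" "norm c = 1"
  shows "dist c (inverse w) > 1 \<longleftrightarrow> Re (c * w) < 1/2"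
  using dist_inverse_gt_1_iff[OF assms(1), of c] assms(2) by auto

lemma dist_diagonal_inverse_gt_1_iff:
  assumes "w \<noteq> 0" "c \<in> gauss_diagonals"
  shows "dist c (inverse w) > 1 \<longleftrightarrow> dist (cnj c) w > 1"
proof -
  have sq: "(Re c)\<^sup>2 = 1" "(Im c)\<^sup>2 = 1"
    using assms(2) by (auto simp: gauss_diagonals_def power2_eq_1_iff abs_if split: if_splits)
  have "dist (cnj c) w > 1 \<longleftrightarrow> 1 < (norm (cnj c - w))\<^sup>2"
    using power_mono_iff[of "norm (cnj c - w)" 1 2] by (simp add: dist_norm flip: not_le)
  also have "(norm (cnj c - w))\<^sup>2 = 2 - 2 * Re (c * w) + (norm w)\<^sup>2"
    unfolding cmod_power2 using sq by (simp add: power2_eq_square algebra_simps)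
  finally show ?thesis
    using dist_inverse_gt_1_iff[OF assms(1), of c] sq
    by (simp add: cmod_power2[of c] algebra_simps del: times_complex.sel)
qed

lemma norm_gauss_units: "c \<in> gauss_units \<Longrightarrow> norm c = 1"
  by (auto simp: gauss_units_def)

lemma open_square_eq_gauss_units: "open_square = {z. \<forall>u\<in>gauss_units. Re (u * z) < 1/2}"
  by (auto simp: open_square_def gauss_units_def)

lemma inverse_in_open_square_iff:
  assumes "w \<noteq> 0"
  shows "inverse w \<in> open_square \<longleftrightarrow> (\<forall>u\<in>gauss_units. dist u w > 1)"
  using dist_unit_inverse_gt_1_iff[of "inverse w"] norm_gauss_units assms
  by (auto simp: open_square_eq_gauss_units)

lemma inverse_in_square_minus_discs_iff:
  assumes w: "w \<noteq> 0" and S: "S \<subseteq> gauss_units \<union> gauss_diagonals"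
  shows "inverse w \<in> square_minus_discs S \<longleftrightarrow>
    (\<forall>c\<in>inverted_centres S. dist c w > 1) \<and> (\<forall>c\<in>S \<inter> gauss_units. Re (c * w) < 1/2)"
proof -
  have "(\<forall>c\<in>S. dist c (inverse w) > 1) \<longleftrightarrow>
      (\<forall>c\<in>S \<inter> gauss_diagonals. dist (cnj c) w > 1) \<and>
      (\<forall>c\<in>S \<inter> gauss_units. Re (c * w) < 1/2)"
    using S dist_diagonal_inverse_gt_1_iff[OF w] dist_unit_inverse_gt_1_iff[OF w norm_gauss_units]
    by blast
  then show ?thesis
    unfolding mem_square_minus_discs_iff inverse_in_open_square_iff[OF w] inverted_centres_def
    by blast
qed

lemma gauss_units_mult_Re_Ints:
  assumes "c \<in> gauss_units" "b \<in> gauss_ints"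
  shows "Re (c * b) \<in> \<int>"
  using assms by (auto simp: gauss_units_def gauss_ints_def)

lemma Re_gauss_unit_mult_less_half_iff:
  assumes c: "c \<in> gauss_units" and b: "b \<in> gauss_ints" and f: "f \<in> open_square"
  shows "Re (c * (b + f)) < 1/2 \<longleftrightarrow> Re (c * b) \<le> 0"
proof -
  have "\<bar>Re (c * f)\<bar> < 1/2"
    using c f by (auto simp: gauss_units_def open_square_def)
  moreover obtain k where "Re (c * b) = of_int k"
    using gauss_units_mult_Re_Ints[OF c b] by (rule Ints_cases)
  ultimately show ?thesis
    by (simp add: distrib_left del: times_complex.sel) linarith
qed

lemma gauss_ints_add_open_square_nonzero:
  assumes b: "b \<in> gauss_ints" "b \<noteq> 0" and f: "f \<in> open_square"
  shows "b + f \<noteq> 0"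
proof
  assume "b + f = 0"
  then have "\<bar>Re b\<bar> < 1" "\<bar>Im b\<bar> < 1"
    using f by (auto simp: complex_eq_iff open_square_def)
  moreover obtain x y where "b = Complex (of_int x) (of_int y)"
    using b(1) by (rule gauss_intsE)
  ultimately show False
    using b(2) by (auto simp: complex_eq_iff)
qed

lemma follower_step_square_minus_discs:
  assumes b: "b \<in> gauss_ints" "b \<noteq> 0" and S: "S \<subseteq> gauss_units \<union> gauss_diagonals"
  shows "follower_step (square_minus_discs S) b =
    (if \<forall>c\<in>S \<inter> gauss_units. Re (c * b) \<le> 0
     then square_minus_discs ((\<lambda>c. c - b) ` inverted_centres S) else {})"
proof (rule set_eqI)
  fix f
  let ?lhs = "f \<in> follower_step (square_minus_discs S) b"
  have "?lhs \<longleftrightarrow> (\<forall>c\<in>inverted_centres S. dist (c - b) f > 1) \<and>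
      (\<forall>c\<in>S \<inter> gauss_units. Re (c * b) \<le> 0)"
    if f: "f \<in> open_square"
  proof -
    have nz: "b + f \<noteq> 0"
      using gauss_ints_add_open_square_nonzero[OF b f] .
    then have "?lhs \<longleftrightarrow> inverse (b + f) \<in> square_minus_discs S"
      using f by (simp add: follower_step_def)
    moreover have "dist (c - b) f = dist c (b + f)" for c
      by (simp add: dist_norm algebra_simps)
    ultimately show ?thesis
      using inverse_in_square_minus_discs_iff[OF nz S]
        Re_gauss_unit_mult_less_half_iff[OF _ b(1) f] by simp
  qed
  moreover have "?lhs \<Longrightarrow> f \<in> open_square"
    by (simp add: follower_step_def)
  ultimately show "?lhs \<longleftrightarrow> f \<in> (if \<forall>c\<in>S \<inter> gauss_units. Re (c * b) \<le> 0
      then square_minus_discs ((\<lambda>c. c - b) ` inverted_centres S) else {})"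
    by (auto simp: mem_square_minus_discs_iff)
qed

lemma follower_step_0:
  assumes "X \<subseteq> open_square"
  shows "follower_step X 0 = {}"
proof -
  have "inverse f \<notin> X" if f: "f \<in> open_square" "f \<noteq> 0" for f
  proof
    assume "inverse f \<in> X"
    then have "norm (inverse f) < 1"
      using assms norm_less_1_if_open_square by blast
    then have "norm f * norm (inverse f) < 1 * 1"
      using norm_less_1_if_open_square[OF f(1)] by (intro mult_strict_mono) auto
    then show False
      using f(2) by (simp flip: norm_mult)
  qed
  then show ?thesis
    by (auto simp: follower_step_def)
qed

lemma square_minus_discs_restrict:
  "square_minus_discs {c \<in> S. \<bar>Re c\<bar> < 3/2 \<and> \<bar>Im c\<bar> < 3/2} = square_minus_discs S"
proof -
  have "\<bar>Re c\<bar> < 3/2 \<and> \<bar>Im c\<bar> < 3/2" if "z \<in> open_square" "\<not> dist c z > 1" for c z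
    using that abs_Re_le_cmod[of "c - z"] abs_Im_le_cmod[of "c - z"]
    by (auto simp: open_square_def dist_norm)
  then show ?thesis
    unfolding set_eq_iff mem_square_minus_discs_iff mem_Collect_eq by blast
qed

lemma square_minus_discs_0:
  assumes "0 \<in> S"
  shows "square_minus_discs S = {}"
  using assms norm_less_1_if_open_square by (force simp: square_minus_discs_def)

lemma quadrant_centres_subset:
  assumes "d \<in> gauss_diagonals"
  shows "quadrant_centres d \<subseteq> gauss_units \<union> gauss_diagonals"
  using assms
  by (auto simp: quadrant_centres_def gauss_diagonals_def gauss_units_def complex_eq_iff abs_if
      split: if_splits)

lemma inverted_centres_subset:
  assumes "S \<subseteq> quadrant_centres d" "d \<in> gauss_diagonals"
  shows "inverted_centres S \<subseteq> insert (cnj d) gauss_units"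
  using assms by (auto simp: inverted_centres_def quadrant_centres_def gauss_diagonals_def)

lemma diff_int_in_0_step:
  fixes m :: real and k :: int
  assumes "m \<in> {-1, 0, 1}" "\<bar>m - of_int k\<bar> < 3/2" "k = 0 \<Longrightarrow> m \<in> {0, e}"
  shows "m - of_int k \<in> {0, if k = 0 then e else - sgn (of_int k)}"
proof (cases "k = 0")
  case True
  then show ?thesis
    using assms(3) by simp
next
  case False
  obtain l where m: "m = of_int l" and l: "l \<in> {-1, 0, 1}"
    using assms(1) by (metis insert_iff empty_iff of_int_0 of_int_1 of_int_minus)
  have "of_int \<bar>l - k\<bar> < (2::real)"
    using assms(2) by (simp add: m)
  then have "\<bar>l - k\<bar> \<le> 1"
    by linarith
  then have "l - k = 0 \<or> l - k = - sgn k"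
    using l False by (auto simp: sgn_if)
  then show ?thesis
    using False by (auto simp: m sgn_if simp flip: of_int_diff)
qed

text \<open>In each nonzero coordinate of \<open>b\<close>, a centre near \<open>b\<close> agrees with \<open>b\<close> or is one step closer
  to \<open>0\<close>. If a coordinate of \<open>b\<close> vanishes, the other one is at least 2 in absolute value, so that \<open>cnj d\<close> is the
  only nearby centre that can differ from \<open>b\<close> in the former.\<close>

lemma nearby_inverted_centres_subset_quadrant_centres:
  assumes d: "d \<in> gauss_diagonals" and S: "S \<subseteq> quadrant_centres d"
    and b: "b \<in> gauss_ints" "b \<noteq> 0" "b \<notin> inverted_centres S"
  shows "\<exists>d'\<in>gauss_diagonals. {c \<in> (\<lambda>c. c - b) ` inverted_centres S.
    \<bar>Re c\<bar> < 3/2 \<and> \<bar>Im c\<bar> < 3/2} \<subseteq> quadrant_centres d'"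
proof -
  obtain x y where xy: "b = Complex (of_int x) (of_int y)"
    using b(1) by (rule gauss_intsE)
  have "b \<notin> gauss_units"
    using b(3) by (simp add: inverted_centres_def)
  then have axes: "x = 0 \<Longrightarrow> \<bar>y\<bar> \<ge> 2" "y = 0 \<Longrightarrow> \<bar>x\<bar> \<ge> 2"
    using b(2) by (auto simp: gauss_units_def xy complex_eq_iff)
  define d' where "d' = Complex (if x = 0 then Re d else - sgn (of_int x))
    (if y = 0 then - Im d else - sgn (of_int y))"
  have "d' \<in> gauss_diagonals"
    using d by (auto simp: d'_def gauss_diagonals_def sgn_if)
  moreover have "c - b \<in> quadrant_centres d'"
    if c: "c \<in> inverted_centres S" and near: "\<bar>Re (c - b)\<bar> < 3/2" "\<bar>Im (c - b)\<bar> < 3/2" for c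
  proof -
    have c_cases: "c = cnj d \<or> c \<in> gauss_units"
      using c inverted_centres_subset[OF S d] by blast
    then have c_coords: "Re c \<in> {-1, 0, 1}" "Im c \<in> {-1, 0, 1}"
      using d by (auto simp: gauss_units_def gauss_diagonals_def abs_eq_iff)
    have "Re c \<in> {0, Re d}" if "x = 0"
      using near(2) axes(1)[OF that] c_cases by (auto simp: xy gauss_units_def)
    then have "Re (c - b) \<in> {0, Re d'}"
      using diff_int_in_0_step[OF c_coords(1)] near(1) by (simp add: d'_def xy)
    moreover have "Im c \<in> {0, - Im d}" if "y = 0"
      using near(1) axes(2)[OF that] c_cases by (auto simp: xy gauss_units_def)
    then have "Im (c - b) \<in> {0, Im d'}"
      using diff_int_in_0_step[OF c_coords(2)] near(2) by (simp add: d'_def xy)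
    moreover have "c \<noteq> b"
      using c b by blast
    ultimately show ?thesis
      by (auto simp: quadrant_centres_def complex_eq_iff)
  qed
  ultimately show ?thesis
    by blast
qed

lemma quadrantal_follower_step:
  assumes E: "quadrantal E" and b: "b \<in> gauss_ints" and nonempty: "follower_step E b \<noteq> {}"
  shows "quadrantal (follower_step E b)"
proof -
  obtain d S where d: "d \<in> gauss_diagonals" and S: "S \<subseteq> quadrant_centres d"
    and E_eq: "E = square_minus_discs S"
    using E unfolding quadrantal_def by blast
  let ?C = "(\<lambda>c. c - b) ` inverted_centres S"
  have "E \<subseteq> open_square"
    by (auto simp: E_eq square_minus_discs_def)
  then have "b \<noteq> 0"
    using nonempty follower_step_0 by blast
  then have step: "follower_step E b = square_minus_discs ?C"
    using follower_step_square_minus_discs[OF b] S quadrant_centres_subset[OF d] nonempty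
    unfolding E_eq by (metis subset_trans)
  have "b \<notin> inverted_centres S"
    using square_minus_discs_0[of ?C] nonempty by (force simp: step)
  then obtain d' where "d' \<in> gauss_diagonals"
    "{c \<in> ?C. \<bar>Re c\<bar> < 3/2 \<and> \<bar>Im c\<bar> < 3/2} \<subseteq> quadrant_centres d'"
    using nearby_inverted_centres_subset_quadrant_centres[OF d S b \<open>b \<noteq> 0\<close>] by blast
  then show ?thesis
    using square_minus_discs_restrict[of ?C] unfolding quadrantal_def step by metis
qed

lemma quadrantal_imp_full_letter:
  assumes "quadrantal E"
  obtains g where "g \<in> gauss_ints" "follower_step E g = open_square"
proof -
  obtain d S where d: "d \<in> gauss_diagonals" and S: "S \<subseteq> quadrant_centres d"
    and E_eq: "E = square_minus_discs S"
    using assms unfolding quadrantal_def by blast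
  define g where "g = - 3 * cnj d"
  let ?C = "(\<lambda>c. c - g) ` inverted_centres S"
  have d_coords: "\<bar>Re d\<bar> = 1" "\<bar>Im d\<bar> = 1"
    using d by (auto simp: gauss_diagonals_def)
  have g: "g \<in> gauss_ints" "g \<noteq> 0"
    using d_coords by (auto simp: g_def gauss_ints_def abs_if complex_eq_iff split: if_splits)
  have half: "\<forall>c\<in>S \<inter> gauss_units. Re (c * g) \<le> 0"
    using S by (auto simp: quadrant_centres_def g_def)
  have "\<bar>Re (c - g)\<bar> \<ge> 2" if "c \<in> inverted_centres S" for c
  proof -
    have "\<bar>Re c\<bar> \<le> 1"
      using that inverted_centres_subset[OF S d] d_coords by (auto simp: gauss_units_def)
    then show ?thesis
      using d_coords by (simp add: g_def)
  qed
  then have far: "{c \<in> ?C. \<bar>Re c\<bar> < 3/2 \<and> \<bar>Im c\<bar> < 3/2} = {}"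
    by fastforce
  have "follower_step E g = square_minus_discs ?C"
    using follower_step_square_minus_discs[OF g] S quadrant_centres_subset[OF d] half
    unfolding E_eq by (metis subset_trans)
  also have "\<dots> = square_minus_discs {}"
    using square_minus_discs_restrict[of ?C] unfolding far by (rule sym)
  also have "\<dots> = open_square"
    by (simp add: square_minus_discs_def)
  finally show thesis
    using that g(1) by blast
qed

lemma quadrantal_followers:
  assumes "w \<in> admissible_words"
  shows "quadrantal (followers w)"
  using assms
proof (induction w rule: rev_induct)
  case Nil
  have "1 + \<i> \<in> gauss_diagonals" "open_square = square_minus_discs {}"
    by (simp_all add: gauss_diagonals_def square_minus_discs_def)
  then show ?case
    unfolding quadrantal_def followers_def by force
next
  case (snoc b w)
  have "w \<in> admissible_words"
    by (intro factor_closedD[OF factor_closed_admissible_words snoc.prems]) simp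
  then show ?case
    using snoc quadrantal_follower_step[of "followers w" b]
    by (simp add: admissible_words_def followers_append)
qed

lemma ex_full_extension:
  assumes "w \<in> admissible_words"
  obtains g where "w @ [g] \<in> full_words"
proof -
  obtain g where "g \<in> gauss_ints" "follower_step (followers w) g = open_square"
    using quadrantal_imp_full_letter[OF quadrantal_followers[OF assms]] .
  then have "w @ [g] \<in> full_words"
    using assms by (simp add: full_words_def admissible_words_def followers_append)
  then show thesis
    using that by blast
qed

subsection \<open>The specification property\<close>

lemma language_Rbar: "language Rbar = admissible_words"
  unfolding Rbar_eq_prefix_shift
proof (rule language_prefix_shift[OF factor_closed_admissible_words])
  show "\<exists>a. w @ [a] \<in> admissible_words" if "w \<in> admissible_words" for w
    using ex_full_extension[OF that] full_words_subset_admissible_words by blast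
qed

lemma ex_full_word_mismatch_le_1:
  assumes "v \<in> admissible_words" "v \<noteq> []"
  shows "\<exists>v'\<in>full_words. length v' = length v \<and> card {j. j < length v \<and> v ! j \<noteq> v' ! j} \<le> 1"
proof -
  obtain u a where v: "v = u @ [a]"
    using assms(2) by (cases v rule: rev_cases) auto
  have "u \<in> admissible_words"
    by (rule factor_closedD[OF factor_closed_admissible_words assms(1)]) (simp add: v)
  then obtain g where "u @ [g] \<in> full_words"
    by (rule ex_full_extension)
  then show ?thesis
    using card_mismatch_last_le[of u a g] by (intro bexI[of _ "u @ [g]"]) (auto simp: v)
qed

theorem theorem1p3:
  "subshift gauss_ints Rbar \<and> right_feeble_specification gauss_ints Rbar"
proof
  show "subshift gauss_ints Rbar"
    unfolding Rbar_eq_prefix_shift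
    by (rule subshift_prefix_shift[OF _ factor_closed_admissible_words])
      (auto simp: admissible_words_def)
  show "right_feeble_specification gauss_ints Rbar"
  proof (rule right_feeble_specification_if_bounded_mismatch[of full_words])
    show "full_words \<subseteq> language Rbar"
      unfolding language_Rbar by (rule full_words_subset_admissible_words)
    show "full_words \<subseteq> lists gauss_ints" "full_words \<noteq> {}"
      using Nil_in_full_words by (auto simp: full_words_def)
  qed (use full_words_append ex_full_word_mismatch_le_1 language_Rbar in blast)+
qed

end
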